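(* For an integer $n\geq 1$, let $G_n$ denote the bipartite graph obtained by deleting a perfect matching from the complete bipartite graph $K_{n,n}$. If $n\neq 1$ and $n\neq 3$, then $q(G_n)=2$.
   Context: For a simple graph $G$ on vertices $1,\ldots,N$, let $\mathcal{S}(G)$ be the set of all $N\times N$ real symmetric matrices $A$ such that for all $i\neq j$, $A_{ij}\neq 0$ if and only if $i$ and $j$ are adjacent in $G$ (the diagonal entries of $A$ are arbitrary). The parameter $q(G)$ is the minimum number of distinct eigenvalues of a matrix in $\mathcal{S}(G)$. *)

theory Defs
  imports
    "Jordan_Normal_Form.Spectral_Radius"
    "Graph_Theory.Graph_Theory"
begin

text \<open>
  Simple graphs are modelled as in \<open>Graph_Theory\<close>: a \<open>pair_graph\<close> is a finite,
  loop-free graph without parallel edges whose arc set is symmetric, so that the edge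
  \<open>{u,v}\<close> is present iff \<open>(u,v)\<close> (equivalently \<open>(v,u)\<close>) is an arc.

  Since the rows and columns of a matrix are indexed from 0, a graph on N vertices has the
  vertex set \<open>{0..<N}\<close> here instead of \<open>{1..N}\<close>; the two definitions that
  follow are meant for such graphs only.
\<close>

definition graph_matrices :: "nat pair_pre_digraph \<Rightarrow> real mat set" where
  "graph_matrices G =
    {A \<in> carrier_mat (card (pverts G)) (card (pverts G)).
      transpose_mat A = A \<and>
      (\<forall>i \<in> pverts G. \<forall>j \<in> pverts G.
        i \<noteq> j \<longrightarrow> (A $$ (i, j) \<noteq> 0 \<longleftrightarrow> (i, j) \<in> parcs G))}"

text \<open>
  Only real eigenvalues are counted, which loses nothing as the matrices are real symmetric.
  The minimum is taken over a nonempty set (\<open>graph_matrices_nonempty\<close>), and all the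
  cardinalities are those of finite sets (\<open>card_finite_spectrum\<close>).
\<close>

definition q_param :: "nat pair_pre_digraph \<Rightarrow> nat" where
  "q_param G = (LEAST k. \<exists>A \<in> graph_matrices G. k = card (spectrum A))"

text \<open>A matching is a set of undirected edges, each given as the set of its two ends.\<close>

definition perfect_matching :: "'a pair_pre_digraph \<Rightarrow> 'a set set \<Rightarrow> bool" where
  "perfect_matching G M \<longleftrightarrow>
    M \<subseteq> {{u, v} | u v. (u, v) \<in> parcs G} \<and>
    (\<forall>v \<in> pverts G. \<exists>!e. e \<in> M \<and> v \<in> e)"

definition delete_edges :: "'a pair_pre_digraph \<Rightarrow> 'a set set \<Rightarrow> 'a pair_pre_digraph" where
  "delete_edges G M =
    \<lparr> pverts = pverts G, parcs = {(u, v) \<in> parcs G. {u, v} \<notin> M} \<rparr>"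

lemma graph_matrices_nonempty:
  assumes "pair_graph G" and "pverts G = {0..<N}"
  shows "graph_matrices G \<noteq> {}"
proof -
  interpret pair_graph G by fact
  let ?A = "mat N N (\<lambda>(i, j). if (i, j) \<in> parcs G then 1 else 0 :: real)"
  have "?A \<in> graph_matrices G"
    unfolding graph_matrices_def assms(2)
    by (auto intro!: eq_matI dest: arcs_symmetric)
  then show ?thesis by blast
qed

lemma pair_graph_delete_edges:
  assumes "pair_graph G"
  shows "pair_graph (delete_edges G M)"
proof -
  interpret pair_graph G by fact
  show ?thesis
    by unfold_locales
      (auto simp: delete_edges_def symmetric_def insert_commute
        intro!: symI finite_subset[OF _ pair_finite_arcs]
        dest: in_arcsD1 in_arcsD2 arcs_symmetric no_loops')
qed

lemma complete_bipartite_perfect_matching_exists: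
  "\<exists>K :: nat pair_pre_digraph. \<exists>M.
    pverts K = {0..<2 * n} \<and> complete_bipartite_digraph n n (with_proj K) \<and> perfect_matching K M"
proof -
  let ?U = "{0..<n}" and ?V = "{n..<2 * n}"
  let ?K = "\<lparr> pverts = {0..<2 * n}, parcs = ?U \<times> ?V \<union> ?V \<times> ?U \<rparr>"
  let ?M = "{{i, n + i} | i. i < n}"
  have "complete_bipartite_digraph n n (with_proj ?K)"
    unfolding complete_bipartite_digraph_pair_def
    by (intro conjI exI[of _ ?U] exI[of _ ?V]) auto
  moreover have "perfect_matching ?K ?M"
    unfolding perfect_matching_def
  proof (intro conjI ballI)
    show "?M \<subseteq> {{u, v} | u v. (u, v) \<in> parcs ?K}" by fastforce
    fix v assume v: "v \<in> pverts ?K"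
    show "\<exists>!e. e \<in> ?M \<and> v \<in> e"
    proof (cases "v < n")
      case True
      then show ?thesis by (intro ex1I[of _ "{v, n + v}"]) auto
    next
      case False
      with v have "v - n < n" "n + (v - n) = v" by auto
      then show ?thesis by (intro ex1I[of _ "{v - n, v}"]) (force, auto)
    qed
  qed
  ultimately show ?thesis by (intro exI[of _ ?K] exI[of _ ?M]) simp
qed

end

theory Submission
  imports Defs
begin

text \<open>
  If \<open>B\<close> is an orthogonal \<open>n\<close> by \<open>n\<close> matrix whose zeros are exactly the diagonal
  entries, then the block matrix with off-diagonal blocks \<open>B\<close> and \<open>B\<close> transposed
  squares to the identity, so its eigenvalues are among 1 and -1, and up to the labelling of
  the vertices its graph is \<open>K\<^bsub>n,n\<^esub>\<close> minus a perfect matching. Such a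
  \<open>B\<close> exists for \<open>n = 2\<close> and \<open>n = 5\<close>, and size \<open>n\<close> yields size
  \<open>n + 2\<close>. Conversely, a real symmetric matrix with a single eigenvalue is scalar, which
  an edge forbids: if \<open>l\<close> is the eigenvalue, then \<open>(A - l I)\<^sup>2\<close> has trace zero
  by triangularisation, and this trace is the sum of the squares of the entries of
  \<open>A - l I\<close>.
\<close>

section \<open>Orthogonal matrices vanishing exactly on the diagonal\<close>

text \<open>Orthonormality is asked of the rows; \<open>orthogonal_zero_diag_columns\<close>
  recovers that of the columns.\<close>

definition orthogonal_zero_diag :: "nat \<Rightarrow> (nat \<Rightarrow> nat \<Rightarrow> real) \<Rightarrow> bool" where
  "orthogonal_zero_diag n B \<longleftrightarrow>
    (\<forall>i<n. \<forall>j<n. (\<Sum>k<n. B i k * B j k) = (if i = j then 1 else 0)) \<and>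
    (\<forall>i<n. \<forall>j<n. B i j = 0 \<longleftrightarrow> i = j)"

lemma orthogonal_zero_diag_2: "orthogonal_zero_diag 2 (\<lambda>i j. if i = j then 0 else 1)"
  by (auto simp: orthogonal_zero_diag_def less_2_cases_iff eval_nat_numeral)

lemma orthogonal_zero_diag_5: "\<exists>B. orthogonal_zero_diag 5 B"
proof -
  define t :: real where "t = sqrt 3"
  have tt: "t * t = 3" by (simp add: t_def)
  have t1: "t > 1" "t < 2" by (auto simp: t_def real_less_lsqrt)
  \<comment> \<open>A circulant with first row \<open>(0, a, b, c, d)\<close> has orthogonal rows iff
    \<open>a b + b c + c d = 0\<close> and \<open>a c + a d + b d = 0\<close>; this is the solution with
    \<open>a = b = 1\<close>.\<close>
  define c where "c = (!) [0, 1, 1, 1 - t, (t - 1) / 2]"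
  \<comment> \<open>For \<open>i < 5\<close> the index is \<open>j - i\<close> modulo 5, written so
    as to avoid truncated subtraction.\<close>
  define g where "g i j = c ((j + (5 - i)) mod 5)" for i j :: nat
  \<comment> \<open>The squared length of each row, \<open>2 + 5 / 4 * (t - 1)^2\<close>, simplified
    by \<open>t * t = 3\<close>.\<close>
  define s where "s = 7 - 5 * t / 2"
  have s: "s > 0" using t1 by (simp add: s_def)
  have lt5: "i < 5 \<longleftrightarrow> i = 0 \<or> i = 1 \<or> i = 2 \<or> i = 3 \<or> i = 4" for i :: nat by auto
  have sum5: "(\<Sum>k<5. f k) = f 0 + f 1 + f 2 + f 3 + f 4" for f :: "nat \<Rightarrow> real"
    by (simp add: eval_nat_numeral)
  have orth: "(\<Sum>k<5. g i k * g j k) = (if i = j then s else 0)" if "i < 5" "j < 5" for i j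
    using that unfolding lt5 sum5 g_def c_def s_def
    by (elim disjE; simp; simp add: field_simps tt)
  have pat: "g i j = 0 \<longleftrightarrow> i = j" if "i < 5" "j < 5" for i j
    using that t1 unfolding lt5 g_def c_def by (elim disjE; simp)
  have "(\<Sum>k<5. g i k / sqrt s * (g j k / sqrt s)) = (\<Sum>k<5. g i k * g j k) / s" for i j
    using s by (simp add: sum_divide_distrib)
  then have "orthogonal_zero_diag 5 (\<lambda>i j. g i j / sqrt s)"
    using orth pat s by (simp add: orthogonal_zero_diag_def)
  then show ?thesis by blast
qed

text \<open>
  Write \<open>M\<close> in blocks \<open>(X, u; v, 0)\<close> and a second such matrix as
  \<open>(0, w; z, C)\<close>. Then \<open>(X, u w; z v, C)\<close> is again orthogonal with exactly the
  diagonal entries zero. The second matrix used here is the weighing matrix \<open>W(4, 3)\<close>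
  divided by \<open>sqrt 3\<close>, whose \<open>w\<close> and \<open>z\<close> are constant.
\<close>
lemma orthogonal_zero_diag_step:
  assumes "orthogonal_zero_diag (Suc m) M"
  shows "\<exists>B. orthogonal_zero_diag (Suc m + 2) B"
proof -
  define r :: real where "r = 1 / sqrt 3"
  have r: "r \<noteq> 0" "r * r = 1 / 3" "r * (r * x) = x / 3" for x
    by (auto simp: r_def)
  define C where "C a b = (if a = b then 0 else if b = (a + 1) mod 3 then r else - r)" for a b :: nat
  define a where "a i = (if i < m then 1 else r)" for i
  \<comment> \<open>\<open>min i m\<close> sends each of the three last rows to the row
    \<open>v\<close> of \<open>M\<close>, scaled by \<open>r\<close>; in the last three columns,
    \<open>u\<close> is repeated with the same factor.\<close>
  define B where "B i j = (if j < m then a i * M (min i m) j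
      else if i < m then r * M i m else C (i - m) (j - m))" for i j
  have Mo: "(\<Sum>k<m. M i k * M j k) = (if i = j then 1 else 0) - M i m * M j m"
    if "i \<le> m" "j \<le> m" for i j
    using assms that by (auto simp: orthogonal_zero_diag_def less_Suc_eq_le algebra_simps)
  have M0: "M i j = 0 \<longleftrightarrow> i = j" if "i \<le> m" "j \<le> m" for i j
    using assms that by (auto simp: orthogonal_zero_diag_def)
  have low: "(\<Sum>k<m. B i k * B j k)
      = a i * a j * ((if min i m = min j m then 1 else 0) - M (min i m) m * M (min j m) m)" for i j
    by (simp add: B_def Mo[symmetric] sum_distrib_left mult_ac)
  have split: "(\<Sum>k<Suc m + 2. f k) = (\<Sum>k<m. f k) + f m + f (m + 1) + f (m + 2)"
    for f :: "nat \<Rightarrow> real" by (simp add: eval_nat_numeral)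
  have cases: "i < m \<or> i = m \<or> i = m + 1 \<or> i = m + 2" if "i < Suc m + 2" for i
    using that by auto
  \<comment> \<open>For two old rows, the three copies of \<open>u\<close> give back the missing
    \<open>M i m * M j m\<close>, as \<open>3 * r * r = 1\<close>. An old and a new row are
    orthogonal since \<open>M m m = 0\<close> and the rows of \<open>C\<close> sum to zero. For two
    new rows, the part \<open>r * r = 1 / 3\<close> from \<open>v\<close> completes the products of
    rows of \<open>C\<close>, which are \<open>2 / 3\<close> or \<open>- 1 / 3\<close>.\<close>
  have "(\<Sum>k<Suc m + 2. B i k * B j k) = (if i = j then 1 else 0)"
    if "i < Suc m + 2" "j < Suc m + 2" for i j
    using cases[OF that(1)] cases[OF that(2)] unfolding split low
    by (elim disjE; simp add: B_def a_def C_def M0 r algebra_simps)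
  moreover have "B i j = 0 \<longleftrightarrow> i = j" if "i < Suc m + 2" "j < Suc m + 2" for i j
    using cases[OF that(1)] cases[OF that(2)]
    by (elim disjE; simp add: B_def a_def C_def M0 r)
  ultimately show ?thesis unfolding orthogonal_zero_diag_def by blast
qed

lemma orthogonal_zero_diag_exists:
  assumes "n \<ge> 2" "n \<noteq> 3"
  shows "\<exists>B. orthogonal_zero_diag n B"
  using assms
proof (induction n rule: less_induct)
  case (less n)
  \<comment> \<open>Descending by 2, even sizes end at 2; odd sizes must stop at 5, before the
    excluded 3.\<close>
  consider "n = 2" | "n = 5" | "n - 2 \<ge> 2" "n - 2 \<noteq> 3" "n = Suc (n - 3) + 2" "Suc (n - 3) = n - 2"
    using less.prems by linarith
  then show ?case
  proof cases
    case 3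
    then have "\<exists>M. orthogonal_zero_diag (n - 2) M" by (intro less.IH) auto
    then show ?thesis using 3 orthogonal_zero_diag_step by metis
  qed (use orthogonal_zero_diag_2 orthogonal_zero_diag_5 in blast)+
qed

text \<open>A one-sided inverse of a square matrix is two-sided.\<close>

lemma orthogonal_zero_diag_columns:
  assumes "orthogonal_zero_diag n B" "i < n" "j < n"
  shows "(\<Sum>k<n. B k i * B k j) = (if i = j then 1 else 0)"
proof -
  define P where "P = mat n n (\<lambda>(i, j). B i j)"
  have P: "P \<in> carrier_mat n n" by (simp add: P_def)
  have "P * transpose_mat P = 1\<^sub>m n"
    using assms(1) by (intro eq_matI)
      (auto simp: P_def scalar_prod_def orthogonal_zero_diag_def lessThan_atLeast0)
  then have "transpose_mat P * P = 1\<^sub>m n"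
    using P by (intro mat_mult_left_right_inverse[of P n "transpose_mat P"]) auto
  then have "(transpose_mat P * P) $$ (i, j) = 1\<^sub>m n $$ (i, j)" by simp
  then show ?thesis
    using assms(2,3) by (simp add: P_def scalar_prod_def lessThan_atLeast0)
qed

section \<open>Lower bound: nonscalar symmetric matrices have two eigenvalues\<close>

text \<open>The Hermitian form \<open>q\<close> of \<open>A\<close> at an eigenvector
  \<open>v\<close> equals its own conjugate, and it is \<open>e\<close> times the nonzero real
  number \<open>s\<close>, the squared norm of \<open>v\<close>.\<close>

lemma symmetric_complex_eigenvalue_real:
  fixes A :: "real mat"
  assumes A: "A \<in> carrier_mat N N" and sym: "transpose_mat A = A"
    and ev: "eigenvalue (map_mat complex_of_real A) e"
  shows "e \<in> \<real>"
proof -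
  have symA: "A $$ (i, j) = A $$ (j, i)" if "i < N" "j < N" for i j
    using arg_cong[OF sym, of "\<lambda>X. X $$ (j, i)"] A that by simp
  obtain v where v: "v \<in> carrier_vec N" "v \<noteq> 0\<^sub>v N"
      and Av: "map_mat complex_of_real A *\<^sub>v v = e \<cdot>\<^sub>v v"
    using ev A by (auto simp: eigenvalue_def eigenvector_def)
  have Av': "(\<Sum>j<N. of_real (A $$ (i, j)) * v $ j) = e * v $ i" if "i < N" for i
    using arg_cong[OF Av, of "\<lambda>x. x $ i"] that A v(1)
    by (simp add: scalar_prod_def lessThan_atLeast0)
  define q where "q = (\<Sum>i<N. \<Sum>j<N. cnj (v $ i) * (of_real (A $$ (i, j)) * v $ j))"
  define s where "s = (\<Sum>i<N. (cmod (v $ i))\<^sup>2)"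
  have qe: "q = e * of_real s"
  proof -
    have "q = (\<Sum>i<N. cnj (v $ i) * (e * v $ i))"
      unfolding q_def sum_distrib_left[symmetric] by (simp add: Av')
    also have "\<dots> = (\<Sum>i<N. e * of_real ((cmod (v $ i))\<^sup>2))"
      by (simp add: complex_norm_square mult_ac del: of_real_power)
    also have "\<dots> = e * of_real s"
      unfolding s_def of_real_sum sum_distrib_left by (rule refl)
    finally show ?thesis .
  qed
  have "cnj q = (\<Sum>i<N. \<Sum>j<N. cnj (v $ j) * (of_real (A $$ (j, i)) * v $ i))"
    unfolding q_def by (auto simp: symA mult_ac intro!: sum.cong)
  also have "\<dots> = q" unfolding q_def by (rule sum.swap)
  finally have "q \<in> \<real>" by (simp add: Reals_cnj_iff)
  moreover have "s \<noteq> 0"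
  proof
    assume "s = 0"
    then have "\<forall>i<N. v $ i = 0" by (simp add: s_def sum_nonneg_eq_0_iff)
    with v show False by (auto intro: eq_vecI)
  qed
  ultimately have "q / of_real s \<in> \<real>" by (intro Reals_divide) auto
  with qe \<open>s \<noteq> 0\<close> show ?thesis by simp
qed

lemma trace_mult_comm:
  fixes A :: "'a :: comm_semiring_0 mat"
  assumes "A \<in> carrier_mat n n" "B \<in> carrier_mat n n"
  shows "sum_list (diag_mat (A * B)) = sum_list (diag_mat (B * A))"
proof -
  have "sum_list (diag_mat (A * B)) = (\<Sum>i<n. \<Sum>j<n. A $$ (i, j) * B $$ (j, i))"
    using assms by (simp add: diag_mat_def interv_sum_list_conv_sum_set_nat scalar_prod_def
        lessThan_atLeast0)
  also have "\<dots> = (\<Sum>j<n. \<Sum>i<n. B $$ (j, i) * A $$ (i, j))"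
    by (subst sum.swap) (simp add: mult.commute)
  also have "\<dots> = sum_list (diag_mat (B * A))"
    using assms by (simp add: diag_mat_def interv_sum_list_conv_sum_set_nat scalar_prod_def
        lessThan_atLeast0)
  finally show ?thesis .
qed

lemma symmetric_nonscalar_two_eigenvalues:
  fixes A :: "real mat"
  assumes A: "A \<in> carrier_mat N N" and sym: "transpose_mat A = A"
    and ij: "i < N" "j < N" "i \<noteq> j" "A $$ (i, j) \<noteq> 0"
  shows "card (spectrum A) \<ge> 2"
proof (rule ccontr)
  assume "\<not> card (spectrum A) \<ge> 2"
  then have "card (spectrum A) \<le> 1" by simp
  then obtain l where l: "spectrum A \<subseteq> {l}"
    using card_finite_spectrum(1)[OF A]
    by (metis card_le_Suc0_iff_eq One_nat_def empty_iff insertI1 subsetI)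
  \<comment> \<open>The characteristic polynomial splits over the complex numbers, its roots are
    real and hence all equal to \<open>l\<close>; so it already splits over the reals, as real
    triangularisation requires.\<close>
  let ?Ac = "map_mat complex_of_real A"
  have Ac: "?Ac \<in> carrier_mat N N" using A by simp
  obtain es where es: "char_poly ?Ac = (\<Prod>e\<leftarrow>es. [:- e, 1:])" "length es = N"
    using char_poly_factorized[OF Ac] by blast
  have hom: "char_poly ?Ac = map_poly of_real (char_poly A)"
    by (rule of_real_hom.char_poly_hom[OF A])
  have "e = of_real l" if "e \<in> set es" for e
  proof -
    have root: "poly (char_poly ?Ac) e = 0"
      using that by (auto simp: es(1) poly_prod_list prod_list_zero_iff)
    then have "eigenvalue ?Ac e" by (simp add: eigenvalue_root_char_poly[OF Ac])
    from symmetric_complex_eigenvalue_real[OF A sym this] obtain x where x: "e = of_real x"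
      by (auto elim: Reals_cases)
    have "poly (char_poly A) x = 0" using root by (simp add: hom x)
    then show ?thesis using l x by (auto simp: spectrum_root_char_poly[OF A])
  qed
  then have "es = replicate N (of_real l)" using es(2) by (metis replicate_eqI)
  interpret of_real_poly_hom: map_poly_inj_comm_ring_hom complex_of_real ..
  have "map_poly complex_of_real (char_poly A) = map_poly of_real (\<Prod>e\<leftarrow>replicate N l. [:- e, 1:])"
    using es(1) hom \<open>es = _\<close> by (simp add: of_real_poly_hom.hom_power)
  then have cp: "char_poly A = (\<Prod>e\<leftarrow>replicate N l. [:- e, 1:])"
    by (rule of_real_poly_hom.injectivity)
  obtain T P Q where "schur_decomposition A (replicate N l) = (T, P, Q)"
    by (metis prod_cases3)
  from schur_decomposition[OF A cp this]
  have wit: "similar_mat_wit A T P Q" and ut: "upper_triangular T"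
    and diag: "diag_mat T = replicate N l" by auto
  note w = similar_mat_witD2[OF A wit]
  define S where "S = T - l \<cdot>\<^sub>m 1\<^sub>m N"
  define D where "D = A - l \<cdot>\<^sub>m 1\<^sub>m N"
  have S: "S \<in> carrier_mat N N" and D: "D \<in> carrier_mat N N" using w by (auto simp: S_def D_def)
  \<comment> \<open>\<open>S\<close> is strictly upper triangular, and similar to \<open>D\<close>
    by the same \<open>P\<close> and \<open>Q\<close> that relate \<open>T\<close> to
    \<open>A\<close>.\<close>
  have S0: "S $$ (a, b) = 0" if "a < N" "b \<le> a" for a b
  proof (cases "b = a")
    case True
    have "T $$ (a, a) = l"
      using arg_cong[OF diag, of "\<lambda>x. x ! a"] w(5) that(1) by (simp add: diag_mat_def)
    then show ?thesis using True that w(5) by (simp add: S_def)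
  next
    case False
    then show ?thesis using that w(5) ut by (auto simp: S_def)
  qed
  have D_eq: "D = P * S * Q"
  proof -
    have "P * S = P * T - l \<cdot>\<^sub>m P"
      unfolding S_def using w(5,6) by (subst mult_minus_distrib_mat[of _ N N _ N])
        (auto simp: mult_smult_distrib[of _ N N])
    then have "P * S * Q = P * T * Q - l \<cdot>\<^sub>m (P * Q)"
      using w(5-7) by (simp add: minus_mult_distrib_mat[of _ N N _ _ N]
          mult_smult_assoc_mat[of _ N N _ N])
    then show ?thesis using w(1,3) by (simp add: D_def)
  qed
  have "D * D = P * (S * S * Q)"
  proof -
    have "D * D = P * S * (Q * P) * S * Q"
      unfolding D_eq using S w(6,7) by (simp add: assoc_mult_mat[of _ N N _ N _ N])
    then show ?thesis using S w(2,6,7) by (simp add: assoc_mult_mat[of _ N N _ N _ N])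
  qed
  moreover have "sum_list (diag_mat (P * (S * S * Q))) = sum_list (diag_mat (S * S * Q * P))"
    by (rule trace_mult_comm[of _ N]) (use S w(6,7) in auto)
  ultimately have "sum_list (diag_mat (D * D)) = sum_list (diag_mat (S * S * Q * P))" by simp
  also have "S * S * Q * P = S * S"
    using S w(2,6,7) by (simp add: assoc_mult_mat[of _ N N _ N _ N])
  also have "sum_list (diag_mat (S * S)) = 0"
  proof -
    \<comment> \<open>One of the positions \<open>(a, b)\<close> and \<open>(b, a)\<close> lies on
      or below the diagonal.\<close>
    have "S $$ (a, b) * S $$ (b, a) = 0" if "a < N" "b < N" for a b
      using S0[of a b] S0[of b a] that by (cases "b \<le> a") auto
    then have "(\<Sum>a = 0..<N. \<Sum>b = 0..<N. S $$ (a, b) * S $$ (b, a)) = 0"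
      by (intro sum.neutral ballI) simp
    then show ?thesis
      using S by (simp add: diag_mat_def interv_sum_list_conv_sum_set_nat scalar_prod_def)
  qed
  finally have "(\<Sum>a<N. \<Sum>b<N. D $$ (a, b) * D $$ (b, a)) = 0"
    using D by (simp add: diag_mat_def interv_sum_list_conv_sum_set_nat scalar_prod_def
        lessThan_atLeast0)
  moreover have "D $$ (b, a) = D $$ (a, b)" if "a < N" "b < N" for a b
    using arg_cong[OF sym, of "\<lambda>X. X $$ (a, b)"] A that by (simp add: D_def)
  ultimately have "(\<Sum>a<N. \<Sum>b<N. D $$ (a, b) * D $$ (a, b)) = 0" by simp
  then have "\<forall>a<N. \<forall>b<N. D $$ (a, b) = 0"
    by (simp add: sum_nonneg_eq_0_iff sum_nonneg)
  then have "D $$ (i, j) = 0" using ij by blast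
  then show False using ij A by (simp add: D_def)
qed

section \<open>Upper bound: eigenvalues of an involution\<close>

lemma involution_spectrum:
  fixes A :: "'a :: field mat"
  assumes A: "A \<in> carrier_mat N N" and AA: "A * A = 1\<^sub>m N"
  shows "spectrum A \<subseteq> {1, - 1}"
proof
  fix k assume "k \<in> spectrum A"
  then obtain v where v: "v \<in> carrier_vec N" "v \<noteq> 0\<^sub>v N" and Av: "A *\<^sub>v v = k \<cdot>\<^sub>v v"
    using A by (auto simp: spectrum_def eigenvalue_def eigenvector_def)
  have "v = (A * A) *\<^sub>v v" using v(1) AA by simp
  also have "\<dots> = A *\<^sub>v (k \<cdot>\<^sub>v v)" using A v(1) Av by (simp add: assoc_mult_mat_vec[of _ N N _ N])
  also have "\<dots> = (k * k) \<cdot>\<^sub>v v"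
    using A v(1) Av by (simp add: mult_mat_vec[of _ N N] smult_smult_assoc)
  finally have kk: "v = (k * k) \<cdot>\<^sub>v v" .
  obtain i where "i < N" "v $ i \<noteq> 0" using v by (metis carrier_vecD eq_vecI index_zero_vec)
  with arg_cong[OF kk, of "\<lambda>x. x $ i"] v(1) have "k * k = 1" by simp
  then show "k \<in> {1, - 1}" by (simp add: square_eq_1_iff)
qed

section \<open>Perfect matchings as partner maps\<close>

lemma perfect_matching_unique:
  assumes "perfect_matching K M" "v \<in> pverts K"
  shows "\<exists>!e. e \<in> M \<and> v \<in> e"
  using assms unfolding perfect_matching_def by (elim conjE) (rule bspec)

lemma perfect_matching_subset:
  assumes "perfect_matching K M"
  shows "M \<subseteq> {{u, v} | u v. (u, v) \<in> parcs K}"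
  using assms unfolding perfect_matching_def by (rule conjunct1)

text \<open>The only matching edge at \<open>v\<close> determines its other end \<open>p v\<close>.
  Seen from \<open>p v\<close>, the same edge leads back to \<open>v\<close>, so \<open>p\<close> is
  an involution that encodes \<open>M\<close>.\<close>

lemma perfect_matching_partner:
  assumes pm: "perfect_matching K M" and g: "pair_graph K"
  shows "\<exists>p. \<forall>v \<in> pverts K. (v, p v) \<in> parcs K \<and> p (p v) = v \<and> (\<forall>w. {v, w} \<in> M \<longleftrightarrow> w = p v)"
proof -
  interpret pair_graph K by (rule g)
  have uniq: "e = e'" if "v \<in> pverts K" "e \<in> M" "v \<in> e" "e' \<in> M" "v \<in> e'" for v e e'
    using ex1E[OF perfect_matching_unique[OF pm that(1)]] that(2-5) by metis
  have "\<exists>w. (v, w) \<in> parcs K \<and> {v, w} \<in> M" if "v \<in> pverts K" for v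
  proof -
    from perfect_matching_unique[OF pm that] obtain e where e: "e \<in> M" "v \<in> e"
      by (elim ex1E conjE)
    from subsetD[OF perfect_matching_subset[OF pm] e(1)]
    obtain a b where ab: "e = {a, b}" "(a, b) \<in> parcs K" by auto
    from ab(2) have "(b, a) \<in> parcs K" by (rule arcs_symmetric)
    with ab e show ?thesis by (auto simp: insert_commute)
  qed
  then have "\<exists>p. \<forall>v \<in> pverts K. (v, p v) \<in> parcs K \<and> {v, p v} \<in> M"
    by (intro bchoice) blast
  then obtain p where p: "\<And>v. v \<in> pverts K \<Longrightarrow> (v, p v) \<in> parcs K"
      "\<And>v. v \<in> pverts K \<Longrightarrow> {v, p v} \<in> M"
    by blast
  have iff: "{v, w} \<in> M \<longleftrightarrow> w = p v" if "v \<in> pverts K" for v w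
    using uniq[OF that, of "{v, w}" "{v, p v}"] p(2)[OF that] by (auto simp: doubleton_eq_iff)
  have "p (p v) = v" if v: "v \<in> pverts K" for v
  proof -
    have "p v \<in> pverts K" using p(1)[OF v] by (rule in_arcsD2)
    then show ?thesis using iff[of "p v" v] p(2)[OF v] by (simp add: insert_commute)
  qed
  with p(1) iff show ?thesis by (intro exI[of _ p]) blast
qed

section \<open>The matrix of the graph and the value of the parameter\<close>

theorem theorem5p3:
  fixes n :: nat and K :: "nat pair_pre_digraph" and M :: "nat set set"
  assumes "n \<ge> 1" and "n \<noteq> 1" and "n \<noteq> 3"
    and "pverts K = {0..<2 * n}"
    and "complete_bipartite_digraph n n (with_proj K)"
    and "perfect_matching K M"
  shows "q_param (delete_edges K M) = 2"
proof -
  let ?G = "delete_edges K M"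
  obtain U V where UV: "{0..<2 * n} = U \<union> V" "U \<inter> V = {}" "card U = n" "card V = n"
      and arcs: "parcs K = U \<times> V \<union> V \<times> U"
    using assms(5) unfolding complete_bipartite_digraph_pair_def assms(4) by blast
  have fin: "finite U" "finite V" using finite_atLeastLessThan[of 0 "2 * n"] unfolding UV(1) by simp_all
  have "\<exists>p. \<forall>v \<in> U \<union> V. (v, p v) \<in> parcs K \<and> p (p v) = v \<and> (\<forall>w. {v, w} \<in> M \<longleftrightarrow> w = p v)"
    using perfect_matching_partner[OF assms(6) pair_graphI_complete_bipartite[OF assms(5)]]
    unfolding assms(4) UV(1) .
  then obtain p where "\<forall>v \<in> U \<union> V. (v, p v) \<in> parcs K \<and> p (p v) = v
      \<and> (\<forall>w. {v, w} \<in> M \<longleftrightarrow> w = p v)" by (elim exE)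
  then have p: "\<And>v. v \<in> U \<union> V \<Longrightarrow> (v, p v) \<in> parcs K"
      "\<And>v. v \<in> U \<union> V \<Longrightarrow> p (p v) = v"
      and M: "\<And>v w. v \<in> U \<union> V \<Longrightarrow> {v, w} \<in> M \<longleftrightarrow> w = p v"
    by blast+
  have pU: "p v \<in> U" if "v \<in> V" for v using p(1)[of v] that UV(2) arcs by auto
  have pV: "p v \<in> V" if "v \<in> U" for v using p(1)[of v] that UV(2) arcs by auto
  have bij_p: "bij_betw p V U"
    by (rule bij_betw_byWitness[of _ p]) (use p(2) pU pV in auto)
  obtain f where f: "bij_betw f U {..<n}"
    using finite_same_card_bij[of U "{..<n}"] fin(1) UV(3) by auto
  \<comment> \<open>A vertex of \<open>V\<close> gets the number of its partner, so matched pairs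
    correspond to diagonal positions of \<open>B\<close>, where the zeros are.\<close>
  have fp: "bij_betw (\<lambda>v. f (p v)) V {..<n}"
    using bij_betw_trans[OF bij_p f] by (simp add: comp_def)
  have f_lt: "f u < n" if "u \<in> U" for u using bij_betwE[OF f] that by auto
  have f_inj: "f u = f w \<longleftrightarrow> u = w" if "u \<in> U" "w \<in> U" for u w
    using f that by (auto simp: bij_betw_def inj_on_def)
  have p_inj: "p v = p w \<longleftrightarrow> v = w" if "v \<in> V" "w \<in> V" for v w
    using bij_p that by (auto simp: bij_betw_def inj_on_def)
  obtain B where B: "orthogonal_zero_diag n B"
    using orthogonal_zero_diag_exists[of n] assms(1-3) by auto
  define h where "h u v = (if u \<in> U then if v \<in> V then B (f u) (f (p v)) else 0
      else if v \<in> U then B (f v) (f (p u)) else 0)" for u v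
  define A where "A = mat (2 * n) (2 * n) (\<lambda>(u, v). h u v)"
  have A: "A \<in> carrier_mat (2 * n) (2 * n)" by (simp add: A_def)
  have in_UV: "i < 2 * n \<longleftrightarrow> i \<in> U \<or> i \<in> V" for i using UV(1) by (simp add: set_eq_iff)
  have h_sym: "h u v = h v u" if "u < 2 * n" "v < 2 * n" for u v
    using that UV(2) by (auto simp: h_def in_UV)
  have h_arc: "h u v \<noteq> 0 \<longleftrightarrow> (u, v) \<in> parcs ?G" if uv: "u < 2 * n" "v < 2 * n" for u v
  proof -
    have *: "h u v \<noteq> 0 \<longleftrightarrow> {u, v} \<notin> M" if "u \<in> U" "v \<in> V" for u v
    proof -
      have "h u v = 0 \<longleftrightarrow> u = p v"
        using B that f_lt pU f_inj by (simp add: h_def orthogonal_zero_diag_def)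
      also have "\<dots> \<longleftrightarrow> {u, v} \<in> M" using M[of v u] that by (simp add: insert_commute)
      finally show ?thesis by simp
    qed
    consider "u \<in> U" "v \<in> V" | "u \<in> V" "v \<in> U" | "u \<in> U" "v \<in> U" | "u \<in> V" "v \<in> V"
      using uv by (auto simp: in_UV)
    then show ?thesis
    proof cases
      case 1
      then show ?thesis using * by (simp add: delete_edges_def arcs)
    next
      case 2
      then show ?thesis using *[of v u] h_sym[OF uv]
        by (simp add: delete_edges_def arcs insert_commute)
    qed (use UV(2) in \<open>auto simp: h_def delete_edges_def arcs\<close>)
  qed
  have A_in: "A \<in> graph_matrices ?G"
    unfolding graph_matrices_def using h_sym h_arc
    by (auto simp: A_def delete_edges_def assms(4) intro!: eq_matI)
  have hh: "(\<Sum>k<2 * n. h u k * h k w) = (if u = w then 1 else 0)"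
    if "u < 2 * n" "w < 2 * n" for u w
  proof -
    have "(\<Sum>k<2 * n. h u k * h k w) = (\<Sum>k\<in>U. h u k * h k w) + (\<Sum>k\<in>V. h u k * h k w)"
      unfolding lessThan_atLeast0 UV(1) by (rule sum.union_disjoint[OF fin UV(2)])
    \<comment> \<open>Sums over \<open>U\<close> are products of columns of \<open>B\<close>; those
      over \<open>V\<close>, treated next, are products of rows.\<close>
    moreover have "(\<Sum>k\<in>U. h u k * h k w) = (if u \<in> V \<and> u = w then 1 else 0)"
    proof (cases "u \<in> V \<and> w \<in> V")
      case True
      then have "(\<Sum>k\<in>U. h u k * h k w) = (\<Sum>k\<in>U. B (f k) (f (p u)) * B (f k) (f (p w)))"
        using UV(2) by (intro sum.cong) (auto simp: h_def)
      also have "\<dots> = (\<Sum>k<n. B k (f (p u)) * B k (f (p w)))"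
        by (rule sum.reindex_bij_betw[OF f])
      also have "\<dots> = (if u = w then 1 else 0)"
        using True pU f_lt f_inj p_inj by (simp add: orthogonal_zero_diag_columns[OF B])
      finally show ?thesis using True by simp
    next
      case False
      then have "(\<Sum>k\<in>U. h u k * h k w) = 0"
        using that UV(2) by (intro sum.neutral) (auto simp: h_def in_UV)
      then show ?thesis using False by auto
    qed
    moreover have "(\<Sum>k\<in>V. h u k * h k w) = (if u \<in> U \<and> u = w then 1 else 0)"
    proof (cases "u \<in> U \<and> w \<in> U")
      case True
      then have "(\<Sum>k\<in>V. h u k * h k w) = (\<Sum>k\<in>V. B (f u) (f (p k)) * B (f w) (f (p k)))"
        using UV(2) by (intro sum.cong) (auto simp: h_def)
      also have "\<dots> = (\<Sum>k<n. B (f u) k * B (f w) k)"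
        by (rule sum.reindex_bij_betw[OF fp])
      also have "\<dots> = (if u = w then 1 else 0)"
        using True f_lt f_inj B by (simp add: orthogonal_zero_diag_def)
      finally show ?thesis using True by simp
    next
      case False
      then have "(\<Sum>k\<in>V. h u k * h k w) = 0"
        using that UV(2) by (intro sum.neutral) (auto simp: h_def in_UV)
      then show ?thesis using False by auto
    qed
    ultimately show ?thesis using that UV(2) by (auto simp: in_UV)
  qed
  then have "A * A = 1\<^sub>m (2 * n)"
    by (intro eq_matI) (auto simp: A_def scalar_prod_def lessThan_atLeast0)
  from card_mono[OF _ involution_spectrum[OF A this]] have le: "card (spectrum A) \<le> 2" by simp
  \<comment> \<open>As \<open>n\<close> is at least 2, \<open>U\<close> has two vertices, and
    joining one to the partner of the other gives an edge outside the matching.\<close>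
  have "\<not> card U \<le> Suc 0" using UV(3) assms(1,2) by simp
  then obtain u w where uw: "u \<in> U" "w \<in> U" "u \<noteq> w"
    unfolding card_le_Suc0_iff_eq[OF fin(1)] by blast
  then have edge: "(u, p w) \<in> parcs ?G"
    using pV M[of u "p w"] p(2)[of u] p(2)[of w] by (auto simp: delete_edges_def arcs)
  have ge: "card (spectrum X) \<ge> 2" if "X \<in> graph_matrices ?G" for X
  proof -
    have "u < 2 * n" "p w < 2 * n" "u \<noteq> p w" using uw pV UV(2) in_UV by auto
    then show ?thesis
      using that edge
      by (intro symmetric_nonscalar_two_eigenvalues[of X "2 * n" u "p w"])
        (auto simp: graph_matrices_def delete_edges_def assms(4))
  qed
  show ?thesis
    unfolding q_param_def using A_in le ge by (intro Least_equality) (auto intro: le_antisym)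
qed

end
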